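(* Let $G=(V,E)$ be a finite, simple, connected graph with $|V|\ge 2$ such that $\mathrm{QEC}(G)<-1/2$. Then the clique graph $\Gamma(G)$ is a tree. Moreover, any two maximal cliques $H_1,H_2$ of $G$ that are adjacent in $\Gamma(G)$ satisfy $|H_1\cap H_2|=1$, and any three mutually distinct maximal cliques $H_1,H_2,H_3$ of $G$ satisfy $H_1\cap H_2\cap H_3=\emptyset$.
   Context: For a finite connected graph $G=(V,E)$ with $|V|\ge2$, let $D=[d_G(x,y)]_{x,y\in V}$ be its distance matrix ($d_G$ the graph distance). The quadratic embedding constant is $\mathrm{QEC}(G)=\max\{\langle f,Df\rangle : f\in\mathbb{R}^V,\ \langle f,f\rangle=1,\ \langle \mathbf{1},f\rangle=0\}$, where $\mathbf{1}$ is the all-ones vector and $\langle\cdot,\cdot\rangle$ the standard inner product. A clique is a nonempty vertex subset inducing a complete graph; a maximal clique is one maximal under inclusion. The clique graph $\Gamma(G)$ has as vertices the maximal cliques of $G$, with two maximal cliques $H_1,H_2$ adjacent iff $H_1\neq H_2$ and $H_1\cap H_2\neq\emptyset$. *)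

theory Defs
  imports "Graph_Theory.Graph_Theory" "HOL-Analysis.Analysis"
begin

text \<open>
  A finite simple undirected graph is a \<^locale>\<open>pair_graph\<close>: a finite, loop-free, symmetric
  digraph without parallel arcs, each undirected edge being represented by its two orientations.
  The connectedness predicate is the one for graphs, written with a qualified name because
  the topological notion has the same base name.
\<close>

definition graph_dist :: "'a pair_pre_digraph \<Rightarrow> 'a \<Rightarrow> 'a \<Rightarrow> nat" where
  "graph_dist G x y = (LEAST n. \<exists>p. pre_digraph.awalk (with_proj G) x p y \<and> length p = n)"

definition vinner :: "'a set \<Rightarrow> ('a \<Rightarrow> real) \<Rightarrow> ('a \<Rightarrow> real) \<Rightarrow> real" where
  "vinner V f g = (\<Sum>x\<in>V. f x * g x)"

definition dist_op :: "'a pair_pre_digraph \<Rightarrow> ('a \<Rightarrow> real) \<Rightarrow> 'a \<Rightarrow> real" where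
  "dist_op G f = (\<lambda>x. \<Sum>y\<in>pverts G. real (graph_dist G x y) * f y)"

text \<open>
  Vectors indexed by the vertex set are functions on the whole type; only their values on
  the vertices matter. The supremum below is a maximum, see \<open>QEC_is_max\<close>.
\<close>

definition QEC_values :: "'a pair_pre_digraph \<Rightarrow> real set" where
  "QEC_values G = {vinner (pverts G) f (dist_op G f) | f.
     vinner (pverts G) f f = 1 \<and> vinner (pverts G) (\<lambda>_. 1) f = 0}"

definition QEC :: "'a pair_pre_digraph \<Rightarrow> real" where
  "QEC G = Sup (QEC_values G)"

definition clique :: "'a pair_pre_digraph \<Rightarrow> 'a set \<Rightarrow> bool" where
  "clique G K \<longleftrightarrow> K \<noteq> {} \<and> K \<subseteq> pverts G \<and> complete_digraph (card K) (with_proj G \<restriction> K)"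

definition maximal_clique :: "'a pair_pre_digraph \<Rightarrow> 'a set \<Rightarrow> bool" where
  "maximal_clique G H \<longleftrightarrow> clique G H \<and> (\<forall>K. clique G K \<and> H \<subseteq> K \<longrightarrow> K = H)"

definition clique_graph :: "'a pair_pre_digraph \<Rightarrow> 'a set pair_pre_digraph" where
  "clique_graph G =
    \<lparr> pverts = {H. maximal_clique G H},
      parcs = {(H1, H2). maximal_clique G H1 \<and> maximal_clique G H2 \<and>
                         H1 \<noteq> H2 \<and> H1 \<inter> H2 \<noteq> {}} \<rparr>"

text \<open>
  In a symmetric digraph every edge yields the closed walk \<open>u, v, u\<close>, which
  \<^const>\<open>pre_digraph.cycle\<close> accepts; hence \<^const>\<open>Digraph_Component.tree\<close> does not
  describe undirected trees. Undirected cycles are exactly those of length at least 3.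
\<close>

definition undirected_tree :: "'a pair_pre_digraph \<Rightarrow> bool" where
  "undirected_tree T \<longleftrightarrow> pair_graph T \<and> Digraph_Component.connected (with_proj T) \<and>
     \<not> (\<exists>p. pre_digraph.cycle (with_proj T) p \<and> 3 \<le> length p)"

lemma clique_iff:
  assumes "pair_graph G"
  shows "clique G K \<longleftrightarrow> K \<noteq> {} \<and> K \<subseteq> pverts G \<and>
    (\<forall>x\<in>K. \<forall>y\<in>K. x \<noteq> y \<longrightarrow> (x, y) \<in> parcs G)"
proof (cases "K \<subseteq> pverts G")
  case True
  interpret pair_graph G by fact
  have ind: "induced_subgraph (with_proj G \<restriction> K) (with_proj G)"
    using True by (intro wf_digraph.induced_induce wf_digraph) auto
  have g: "graph (with_proj G \<restriction> K)"
    using digraphI_induced[OF ind] induced_graph_imp_symmetric[OF sym_arcs ind]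
    by (rule digraph.graphI)
  have ends: "arcs_ends (with_proj G \<restriction> K) = {(u, v). (u, v) \<in> parcs G \<and> u \<in> K \<and> v \<in> K}"
    by (auto simp: arcs_ends_conv image_iff)
  have noloop: "\<And>x. (x, x) \<notin> parcs G" using pair_no_loops by fastforce
  have "{(u, v). (u, v) \<in> parcs G \<and> u \<in> K \<and> v \<in> K} = {(u, v). (u, v) \<in> K \<times> K \<and> u \<noteq> v}
      \<longleftrightarrow> (\<forall>x\<in>K. \<forall>y\<in>K. x \<noteq> y \<longrightarrow> (x, y) \<in> parcs G)" (is "?L = ?R \<longleftrightarrow> ?P")
  proof
    assume eq: "?L = ?R"
    have "(x, y) \<in> ?L" if "x \<in> K" "y \<in> K" "x \<noteq> y" for x y
      unfolding eq using that by simp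
    then show ?P by blast
  qed (use noloop in auto)
  then show ?thesis
    using g True by (simp add: clique_def complete_digraph_def ends)
qed (auto simp: clique_def)

lemma QEC_is_max:
  assumes fin: "finite (pverts G)" and two: "2 \<le> card (pverts G)"
  shows "QEC G \<in> QEC_values G" and "\<forall>q\<in>QEC_values G. q \<le> QEC G"
proof -
  define V where "V = pverts G"
  define F where "F f = vinner V f (dist_op G f)" for f
  define C where "C = {f. vinner V f f = 1} \<inter> {f. vinner V (\<lambda>_. 1) f = 0}"
  define B where "B = PiE UNIV (\<lambda>i. if i \<in> V then {-1..1} else {0::real})"
  have finV: "finite V" using fin V_def by simp
  have cB: "compact B"
  proof -
    have "compactin (product_topology (\<lambda>i. euclidean) UNIV) B"
      unfolding B_def compactin_PiE by auto
    then show ?thesis by (simp add: euclidean_product_topology)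
  qed
  have coord: "continuous_on UNIV (\<lambda>f :: 'a \<Rightarrow> real. f x)" for x
    by (rule continuous_on_product_coordinates)
  have contF: "continuous_on UNIV F"
    unfolding F_def vinner_def dist_op_def by (intro continuous_intros coord)
  have c1: "continuous_on UNIV (\<lambda>f. vinner V f f)"
    and c2: "continuous_on UNIV (\<lambda>f. vinner V (\<lambda>_. 1) f)"
    unfolding vinner_def by (intro continuous_intros coord)+
  have clC: "closed C"
    unfolding C_def by (intro closed_Int closed_Collect_eq c1 c2 continuous_on_const)
  have comp: "compact (B \<inter> C)" using cB clC by (rule compact_Int_closed)
  have restr: "\<exists>g\<in>B \<inter> C. F g = F f" if f: "f \<in> C" for f
  proof -
    define g where "g = (\<lambda>i. if i \<in> V then f i else 0)"
    have "F g = F f" "vinner V g g = vinner V f f"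
      "vinner V (\<lambda>_. 1) g = vinner V (\<lambda>_. 1) f"
      unfolding F_def vinner_def dist_op_def g_def V_def by (auto intro!: sum.cong)
    moreover have "\<bar>f i\<bar> \<le> 1" if "i \<in> V" for i
    proof -
      have "f i * f i \<le> vinner V f f"
        unfolding vinner_def using finV that by (intro member_le_sum) auto
      then have "(f i)\<^sup>2 \<le> 1" using f by (simp add: C_def power2_eq_square)
      then show ?thesis by (simp add: abs_square_le_1)
    qed
    then have "g \<in> B" unfolding B_def g_def by (force simp: abs_le_iff)
    ultimately show ?thesis using f unfolding C_def by auto
  qed
  obtain x y where xy: "x \<in> V" "y \<in> V" "x \<noteq> y"
    using two finV unfolding V_def by (metis card_le_Suc0_iff_eq not_less_eq_eq numeral_2_eq_2)
  define h where "h = (\<lambda>i. if i = x then 1 / sqrt 2 else if i = y then - (1 / sqrt 2) else 0 :: real)"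
  have hsum: "(\<Sum>i\<in>V. k (h i)) = (\<Sum>i\<in>{x, y}. k (h i))" if "k 0 = 0" for k :: "real \<Rightarrow> real"
    using xy finV that by (intro sum.mono_neutral_right) (auto simp: h_def)
  have "h \<in> C"
    using hsum[of "\<lambda>t. t * t"] hsum[of "\<lambda>t. t"] xy unfolding C_def vinner_def
    by (simp add: h_def)
  then have "B \<inter> C \<noteq> {}" using restr by blast
  then obtain m where m: "m \<in> B \<inter> C" "\<forall>f\<in>B \<inter> C. F f \<le> F m"
    using continuous_attains_sup[OF comp] continuous_on_subset[OF contF] by blast
  have vals: "QEC_values G = F ` C"
    unfolding QEC_values_def C_def F_def V_def by auto
  have ub: "\<forall>q\<in>QEC_values G. q \<le> F m"
  proof
    fix q assume "q \<in> QEC_values G"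
    then obtain f where "f \<in> C" "q = F f" unfolding vals by blast
    then show "q \<le> F m" using restr[of f] m(2) by metis
  qed
  have "QEC G = F m"
    unfolding QEC_def using m ub vals by (intro cSup_eq_maximum) auto
  then show "QEC G \<in> QEC_values G" "\<forall>q\<in>QEC_values G. q \<le> QEC G"
    using ub m vals by auto
qed

end

theory Submission
  imports Defs
begin

text \<open>
  The hypothesis says that the form of \<open>D + I/2\<close> is negative definite on the vectors of sum zero.
  Testing it with \<open>\<delta>\<^sub>a - \<delta>\<^sub>b + \<delta>\<^sub>c - \<delta>\<^sub>e\<close> for disjoint edges \<open>ab\<close> and \<open>ce\<close> gives
  \<open>d(a,c) + d(b,e) = d(a,e) + d(b,c)\<close>, because distances are integers. Hence
  \<open>h(z) = d(a,z) - d(b,z)\<close> is constant along every path avoiding the edge \<open>ab\<close>. This rules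
  out induced diamonds, so distinct maximal cliques share at most one vertex. Testing with
  \<open>(-3,1,1,1)\<close> rules out induced claws, so a vertex lies in at most two maximal cliques.
  Choosing a common vertex \<open>x\<^sub>i\<close> of consecutive cliques on a cycle of the clique graph gives a
  closed walk in \<open>G\<close> along which, for the edge \<open>x\<^sub>0x\<^sub>1\<close>, \<open>h\<close> is positive at \<open>x\<^sub>2\<close> but not
  at the last vertex, a contradiction.
\<close>

section \<open>The quadratic form of the distance matrix on test vectors\<close>

text \<open>Both sides are homogeneous of degree two, so \<open>f\<close> may be scaled to unit norm
  unless it vanishes on the vertices. This admits integer test vectors.\<close>

lemma QEC_bound:
  assumes fin: "finite (pverts G)" and two: "2 \<le> card (pverts G)"
    and f0: "vinner (pverts G) (\<lambda>_. 1) f = 0"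
  shows "vinner (pverts G) f (dist_op G f) \<le> QEC G * vinner (pverts G) f f"
proof (cases "\<forall>x\<in>pverts G. f x = 0")
  case True
  then show ?thesis by (simp add: vinner_def)
next
  case False
  define s where "s = vinner (pverts G) f f"
  obtain x where x: "x \<in> pverts G" "f x \<noteq> 0" using False by blast
  have "0 < f x * f x" using x(2) by (metis not_real_square_gt_zero)
  then have "s > 0"
    unfolding s_def vinner_def using sum_pos2[OF fin x(1), of "\<lambda>x. f x * f x"] by simp
  define g where "g x = f x / sqrt s" for x
  have "vinner (pverts G) g g = (\<Sum>x\<in>pverts G. f x * f x / s)"
    unfolding vinner_def g_def using \<open>s > 0\<close> by (intro sum.cong) auto
  also have "\<dots> = 1"
    using \<open>s > 0\<close> by (simp add: s_def vinner_def flip: sum_divide_distrib)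
  finally have g1: "vinner (pverts G) g g = 1" .
  have g0: "vinner (pverts G) (\<lambda>_. 1) g = 0"
    using f0 by (simp add: vinner_def g_def flip: sum_divide_distrib)
  have "dist_op G g x = dist_op G f x / sqrt s" for x
    by (simp add: dist_op_def g_def sum_divide_distrib)
  then have "vinner (pverts G) g (dist_op G g)
      = (\<Sum>x\<in>pverts G. f x * dist_op G f x / s)"
    unfolding vinner_def g_def using \<open>s > 0\<close> by (intro sum.cong) auto
  also have "\<dots> = vinner (pverts G) f (dist_op G f) / s"
    by (simp add: vinner_def sum_divide_distrib)
  finally have gD: "vinner (pverts G) g (dist_op G g) = vinner (pverts G) f (dist_op G f) / s" .
  have "vinner (pverts G) g (dist_op G g) \<in> QEC_values G"
    unfolding QEC_values_def using g0 g1 by blast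
  then have "vinner (pverts G) f (dist_op G f) / s \<le> QEC G"
    using QEC_is_max(2)[OF fin two] gD by auto
  then show ?thesis
    using \<open>s > 0\<close> by (simp add: s_def field_simps)
qed

text \<open>For a test vector on four vertices this leaves sixteen explicit terms, which
  \<open>simp\<close> can expand.\<close>

lemma vinner_dist_op_support:
  assumes "finite (pverts G)" "S \<subseteq> pverts G" "\<And>x. x \<notin> S \<Longrightarrow> f x = 0"
  shows "vinner (pverts G) f (dist_op G f) = (\<Sum>x\<in>S. \<Sum>y\<in>S. real (graph_dist G x y) * (f x * f y))"
proof -
  have "dist_op G f x = (\<Sum>y\<in>S. real (graph_dist G x y) * f y)" for x
    unfolding dist_op_def using assms by (intro sum.mono_neutral_right) auto
  moreover have "vinner (pverts G) f (dist_op G f) = (\<Sum>x\<in>S. f x * dist_op G f x)"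
    unfolding vinner_def using assms by (intro sum.mono_neutral_right) auto
  ultimately show ?thesis
    by (simp add: sum_distrib_left mult.left_commute)
qed

lemma vinner_support:
  assumes "finite V" "S \<subseteq> V" "\<And>x. x \<notin> S \<Longrightarrow> f x = 0"
  shows "vinner V g f = (\<Sum>x\<in>S. g x * f x)"
  unfolding vinner_def using assms by (intro sum.mono_neutral_right) auto

section \<open>Arcs and vertices of a walk by position\<close>

lemma pcas_nth:
  assumes "pcas u p v" "Suc i < length p"
  shows "fst (p ! Suc i) = snd (p ! i)"
  using assms
proof (induction p arbitrary: u i)
  case (Cons e p)
  then show ?case by (cases i; cases p) auto
qed simp

lemma pcas_ends:
  assumes "pcas u p v" "p \<noteq> []"
  shows "fst (hd p) = u" "snd (last p) = v"
proof -
  show "fst (hd p) = u" using assms by (cases p) auto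
  show "snd (last p) = v" using assms
  proof (induction p arbitrary: u)
    case (Cons e p)
    then show ?case by (cases p) auto
  qed simp
qed

lemma pcas_pawalk_verts:
  assumes "pcas u p v"
  shows "pawalk_verts u p = u # map snd p"
  using assms by (induction p arbitrary: u) auto

section \<open>Graph distance in a connected graph\<close>

locale connected_pair_graph = pair_graph +
  assumes connected: "Digraph_Component.connected (with_proj G)"
begin

lemma arc_sym: "(x, y) \<in> parcs G \<Longrightarrow> (y, x) \<in> parcs G"
  using pair_sym_arcs by (auto simp: symmetric_def sym_def)

lemma arc_distinct: "(x, y) \<in> parcs G \<Longrightarrow> x \<noteq> y"
  using pair_no_loops by fastforce

lemma all_reachable:
  assumes "x \<in> pverts G" "y \<in> pverts G"
  shows "x \<rightarrow>\<^sup>*\<^bsub>with_proj G\<^esub> y"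
  using symmetric_connected_imp_strongly_connected[OF sym_arcs connected] assms
  by (auto simp: strongly_connected_def)

lemma graph_dist_walk:
  assumes "x \<in> pverts G" "y \<in> pverts G"
  obtains p where "awalk x p y" "length p = graph_dist G x y"
proof -
  have "\<exists>n p. awalk x p y \<and> length p = n"
    using all_reachable[OF assms] by (simp add: reachable_awalk)
  then have "\<exists>p. awalk x p y \<and> length p = graph_dist G x y"
    unfolding graph_dist_def by (rule LeastI_ex)
  then show ?thesis using that by blast
qed

lemma graph_dist_le: "awalk x p y \<Longrightarrow> graph_dist G x y \<le> length p"
  unfolding graph_dist_def by (intro Least_le) blast

lemma graph_dist_self [simp]: "x \<in> pverts G \<Longrightarrow> graph_dist G x x = 0"
  using graph_dist_le[of x "[]" x] by (simp add: awalk_simps)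

lemma graph_dist_pos:
  assumes "x \<in> pverts G" "y \<in> pverts G" "x \<noteq> y"
  shows "1 \<le> graph_dist G x y"
proof -
  obtain p where "awalk x p y" "length p = graph_dist G x y"
    using graph_dist_walk assms by blast
  then show ?thesis using assms by (cases p) (auto simp: awalk_simps)
qed

lemma graph_dist_arc:
  assumes "(x, y) \<in> parcs G"
  shows "graph_dist G x y = 1"
proof -
  have "graph_dist G x y \<le> 1"
    using graph_dist_le[of x "[(x, y)]" y] assms by (simp add: awalk_simps in_arcsD2)
  then show ?thesis
    using graph_dist_pos[of x y] assms in_arcsD1 in_arcsD2 arc_distinct by force
qed

lemma graph_dist_ge_2:
  assumes "x \<in> pverts G" "y \<in> pverts G" "x \<noteq> y" "(x, y) \<notin> parcs G"
  shows "2 \<le> graph_dist G x y"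
proof -
  obtain p where p: "awalk x p y" "length p = graph_dist G x y"
    using graph_dist_walk assms by blast
  have "length p \<noteq> 1"
    using p(1) assms by (auto simp: length_Suc_conv awalk_simps)
  then show ?thesis using graph_dist_pos[OF assms(1-3)] p(2) by linarith
qed

lemma graph_dist_commute: "graph_dist G x y = graph_dist G y x"
proof -
  have "length (rev_path p) = length p" for p :: "('a \<times> 'a) list"
    by (induction p) auto
  then have "(\<exists>p. awalk x p y \<and> length p = n) \<longleftrightarrow> (\<exists>p. awalk y p x \<and> length p = n)" for n
    by (metis awalk_rev_path)
  then show ?thesis by (simp add: graph_dist_def)
qed

section \<open>Cliques and maximal cliques\<close>

lemma clique_arc: "clique G K \<Longrightarrow> x \<in> K \<Longrightarrow> y \<in> K \<Longrightarrow> x \<noteq> y \<Longrightarrow> (x, y) \<in> parcs G"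
  using clique_iff[OF pair_graph_axioms] by blast

lemma clique_subset: "clique G K \<Longrightarrow> K \<subseteq> pverts G"
  by (simp add: clique_def)

lemma maximal_clique_clique: "maximal_clique G H \<Longrightarrow> clique G H"
  by (simp add: maximal_clique_def)

lemma maximal_clique_subset_eq:
  "maximal_clique G H \<Longrightarrow> maximal_clique G H' \<Longrightarrow> H \<subseteq> H' \<Longrightarrow> H = H'"
  by (auto simp: maximal_clique_def)

text \<open>Distinct maximal cliques are incomparable, so \<open>H\<close> has a vertex outside
  \<open>H'\<close>, and this cannot be \<open>x\<close>.\<close>

lemma maximal_clique_other_vertex:
  assumes H: "maximal_clique G H" "maximal_clique G H'" "H \<noteq> H'" and x: "x \<in> H" "x \<in> H'"
  obtains y where "y \<in> H" "y \<noteq> x"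
  using maximal_clique_subset_eq[OF H(1,2)] H(3) x by blast

lemma clique_extends:
  assumes "clique G K"
  obtains H where "maximal_clique G H" "K \<subseteq> H"
proof -
  have "finite {K. clique G K}"
    by (rule finite_subset[of _ "Pow (pverts G)"]) (auto simp: pair_finite_verts dest: clique_subset)
  then obtain H where "H \<in> {K. clique G K}" "K \<subseteq> H" "\<forall>L\<in>{K. clique G K}. H \<subseteq> L \<longrightarrow> H = L"
    using finite_has_maximal2[of "{K. clique G K}" K] assms by auto
  then show ?thesis using that unfolding maximal_clique_def by blast
qed

lemma vertex_in_maximal_clique:
  assumes "x \<in> pverts G"
  obtains H where "maximal_clique G H" "x \<in> H"
proof -
  have "clique G {x}" using assms by (simp add: clique_iff[OF pair_graph_axioms])
  then obtain H where "maximal_clique G H" "{x} \<subseteq> H" by (rule clique_extends)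
  then show ?thesis using that by simp
qed

lemma arc_in_maximal_clique:
  assumes "(x, y) \<in> parcs G"
  obtains H where "maximal_clique G H" "x \<in> H" "y \<in> H"
proof -
  have "clique G {x, y}"
    using assms in_arcsD1 in_arcsD2 arc_sym by (auto simp: clique_iff[OF pair_graph_axioms])
  then obtain H where "maximal_clique G H" "{x, y} \<subseteq> H" by (rule clique_extends)
  then show ?thesis using that by simp
qed

section \<open>The clique graph is simple and connected\<close>

lemma pair_graph_clique_graph: "pair_graph (clique_graph G)"
proof -
  have fin: "finite {H. maximal_clique G H}"
    by (rule finite_subset[of _ "Pow (pverts G)"])
      (auto simp: pair_finite_verts dest: maximal_clique_clique clique_subset)
  have "finite (parcs (clique_graph G))"
    by (rule finite_subset[of _ "{H. maximal_clique G H} \<times> {H. maximal_clique G H}"])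
      (auto simp: clique_graph_def fin)
  moreover have "symmetric (clique_graph G)"
    by (auto simp: clique_graph_def symmetric_def sym_def)
  ultimately show ?thesis
    using fin by unfold_locales (auto simp: clique_graph_def)
qed

text \<open>A walk in \<open>G\<close> lifts to the clique graph: each arc lies in a maximal clique,
  and the cliques of consecutive arcs share a vertex, so they are equal or adjacent.\<close>

lemma connected_clique_graph: "Digraph_Component.connected (with_proj (clique_graph G))"
proof -
  interpret C: pair_graph "clique_graph G" by (rule pair_graph_clique_graph)
  let ?C = "with_proj (clique_graph G)"
  have common: "H \<rightarrow>\<^sup>*\<^bsub>?C\<^esub> H'" if "maximal_clique G H" "maximal_clique G H'" "x \<in> H" "x \<in> H'" for H H' x
  proof (cases "H = H'")
    case True
    have "H \<in> pverts (clique_graph G)" using that by (simp add: clique_graph_def)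
    then show ?thesis using True by simp
  next
    case False
    then have "(H, H') \<in> parcs (clique_graph G)" using that by (auto simp: clique_graph_def)
    then show ?thesis by (intro C.reachable_adjI) simp
  qed
  \<comment> \<open>Induction on the end of the walk, with \<open>H'\<close> arbitrary because the
    final clique changes with the last vertex.\<close>
  have reach: "H \<rightarrow>\<^sup>*\<^bsub>?C\<^esub> H'"
    if "x \<rightarrow>\<^sup>*\<^bsub>with_proj G\<^esub> y" "maximal_clique G H" "maximal_clique G H'" "x \<in> H" "y \<in> H'" for x y H H'
    using that(1,3,5)
  proof (induction arbitrary: H' rule: reachable_induct)
    case base
    then show ?case using common that by blast
  next
    case (step y z)
    obtain K where K: "maximal_clique G K" "y \<in> K" "z \<in> K"
      using step.hyps(2) arc_in_maximal_clique by auto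
    have "H \<rightarrow>\<^sup>*\<^bsub>?C\<^esub> K" using step.IH K by blast
    also have "K \<rightarrow>\<^sup>*\<^bsub>?C\<^esub> H'" using common K step.prems by blast
    finally show ?case .
  qed
  show ?thesis
  proof (rule C.connectedI)
    obtain x where "x \<in> pverts G"
      using symmetric_connected_imp_strongly_connected[OF sym_arcs connected]
      by (auto simp: strongly_connected_def)
    then show "pverts (clique_graph G) \<noteq> {}"
      using vertex_in_maximal_clique[of x] by (auto simp: clique_graph_def)
  next
    fix H H' assume "H \<in> pverts (clique_graph G)" "H' \<in> pverts (clique_graph G)"
    then have H: "maximal_clique G H" "maximal_clique G H'" by (auto simp: clique_graph_def)
    obtain x y where xy: "x \<in> H" "y \<in> H'"
      using H[THEN maximal_clique_clique] by (auto simp: clique_def)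
    have "x \<rightarrow>\<^sup>*\<^bsub>with_proj G\<^esub> y"
      using xy H[THEN maximal_clique_clique, THEN clique_subset] by (intro all_reachable) auto
    then have "H \<rightarrow>\<^sup>*\<^bsub>?C\<^esub> H'" using reach H xy by blast
    then show "H \<rightarrow>\<^sup>*\<^bsub>with_proj (mk_symmetric ?C)\<^esub> H'" by (rule C.reachable_mk_symmetricI)
  qed
qed

end

section \<open>Local structure forced by the bound on the constant\<close>

locale small_QEC_graph = connected_pair_graph +
  assumes card_ge_2: "2 \<le> card (pverts G)"
    and QEC_less: "QEC G < - (1 / 2)"
begin

lemma quadratic_form_less:
  assumes "S \<subseteq> pverts G" "\<And>x. x \<notin> S \<Longrightarrow> f x = 0" "sum f S = 0" "0 < (\<Sum>x\<in>S. f x * f x)"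
  shows "(\<Sum>x\<in>S. \<Sum>y\<in>S. real (graph_dist G x y) * (f x * f y)) < - (1 / 2) * (\<Sum>x\<in>S. f x * f x)"
proof -
  note supp = vinner_support[OF pair_finite_verts assms(1,2)]
  have "vinner (pverts G) f (dist_op G f) \<le> QEC G * vinner (pverts G) f f"
    using assms supp by (intro QEC_bound pair_finite_verts card_ge_2) simp
  also have "\<dots> < - (1 / 2) * vinner (pverts G) f f"
    using assms supp by (intro mult_strict_right_mono QEC_less) auto
  finally show ?thesis
    using vinner_dist_op_support[OF pair_finite_verts assms(1,2)] supp by simp
qed

text \<open>The test vector has squared norm 4, so its form is below -2. The form is twice d(a,c) +
  d(b,e) - d(a,e) - d(b,c) - 2, so the alternating sum of the four distances is below 1, hence at
  most 0 as an integer.\<close>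

lemma disjoint_arcs_dist_le:
  assumes ab: "(a, b) \<in> parcs G" and ce: "(c, e) \<in> parcs G"
    and neq: "a \<noteq> c" "a \<noteq> e" "b \<noteq> c" "b \<noteq> e"
  shows "graph_dist G a c + graph_dist G b e \<le> graph_dist G a e + graph_dist G b c"
proof -
  define f :: "'a \<Rightarrow> real" where
    "f x = (if x = a \<or> x = c then 1 else if x = b \<or> x = e then - 1 else 0)" for x
  note d = neq neq[symmetric] arc_distinct[OF ab] arc_distinct[OF ce]
    arc_distinct[OF ab, symmetric] arc_distinct[OF ce, symmetric]
  have f: "f a = 1" "f b = - 1" "f c = 1" "f e = - 1"
    using d by (auto simp: f_def)
  have V: "a \<in> pverts G" "b \<in> pverts G" "c \<in> pverts G" "e \<in> pverts G"
    using ab ce in_arcsD1 in_arcsD2 by auto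
  have "(\<Sum>x\<in>{a,b,c,e}. \<Sum>y\<in>{a,b,c,e}. real (graph_dist G x y) * (f x * f y))
      < - (1 / 2) * (\<Sum>x\<in>{a,b,c,e}. f x * f x)"
    using V d by (intro quadratic_form_less) (auto simp: f f_def)
  then show ?thesis
    using V d graph_dist_arc[OF ab] graph_dist_arc[OF ce]
      graph_dist_commute[of b a] graph_dist_commute[of c a] graph_dist_commute[of e a]
      graph_dist_commute[of c b] graph_dist_commute[of e b] graph_dist_commute[of e c]
    by (simp add: f)
qed

text \<open>Reversing the arc \<open>(c, e)\<close> gives the opposite inequality.\<close>

lemma disjoint_arcs_dist_eq:
  assumes "(a, b) \<in> parcs G" "(c, e) \<in> parcs G" "a \<noteq> c" "a \<noteq> e" "b \<noteq> c" "b \<noteq> e"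
  shows "graph_dist G a c + graph_dist G b e = graph_dist G a e + graph_dist G b c"
  using disjoint_arcs_dist_le[of a b c e] disjoint_arcs_dist_le[of a b e c] assms arc_sym[of c e]
  by linarith

text \<open>The test vector has squared norm 12, so its form is below -6. In an induced claw the
  leaves are at mutual distance at least 2, so the form is at least 2 * (-9 + 6) = -6.\<close>

lemma claw_free:
  assumes arcs: "(x, a) \<in> parcs G" "(x, b) \<in> parcs G" "(x, c) \<in> parcs G"
    and neq: "a \<noteq> b" "a \<noteq> c" "b \<noteq> c"
    and "(a, b) \<notin> parcs G" "(a, c) \<notin> parcs G"
  shows "(b, c) \<in> parcs G"
proof (rule ccontr)
  assume bc: "(b, c) \<notin> parcs G"
  define f :: "'a \<Rightarrow> real" where
    "f y = (if y = x then - 3 else if y = a \<or> y = b \<or> y = c then 1 else 0)" for y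
  note d = neq neq[symmetric] arcs[THEN arc_distinct] arcs[THEN arc_distinct, symmetric]
  have f: "f x = - 3" "f a = 1" "f b = 1" "f c = 1"
    using d by (auto simp: f_def)
  have V: "x \<in> pverts G" "a \<in> pverts G" "b \<in> pverts G" "c \<in> pverts G"
    using arcs in_arcsD1 in_arcsD2 by auto
  have "(\<Sum>y\<in>{x,a,b,c}. \<Sum>z\<in>{x,a,b,c}. real (graph_dist G y z) * (f y * f z))
      < - (1 / 2) * (\<Sum>y\<in>{x,a,b,c}. f y * f y)"
    using V d by (intro quadratic_form_less) (auto simp: f f_def)
  moreover have "2 \<le> graph_dist G a b" "2 \<le> graph_dist G a c" "2 \<le> graph_dist G b c"
    using assms V bc by (auto intro: graph_dist_ge_2)
  ultimately show False
    using V d arcs[THEN graph_dist_arc]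
      graph_dist_commute[of a x] graph_dist_commute[of b x] graph_dist_commute[of c x]
      graph_dist_commute[of b a] graph_dist_commute[of c a] graph_dist_commute[of c b]
    by (simp add: f)
qed

text \<open>Otherwise the union is not a clique, and nonadjacent \<open>a\<close>, \<open>b\<close>
  from the two cliques form a diamond with \<open>c\<close>, \<open>e\<close>. For the arcs
  \<open>(a, c)\<close> and \<open>(b, e)\<close> the distance identity then equates a sum of at
  least 2 + 1 with 1 + 1.\<close>

lemma maximal_cliques_eq:
  assumes H: "maximal_clique G H1" "maximal_clique G H2"
    and c: "c \<in> H1" "c \<in> H2" and e: "e \<in> H1" "e \<in> H2" and "c \<noteq> e"
  shows "H1 = H2"
proof (rule ccontr)
  assume "H1 \<noteq> H2"
  note cl = H[THEN maximal_clique_clique]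
  have "\<not> clique G (H1 \<union> H2)"
    using H \<open>H1 \<noteq> H2\<close> unfolding maximal_clique_def by (metis Un_upper1 Un_upper2)
  then obtain x y where xy: "x \<in> H1 \<union> H2" "y \<in> H1 \<union> H2" "x \<noteq> y" "(x, y) \<notin> parcs G"
    using c cl[THEN clique_subset] unfolding clique_iff[OF pair_graph_axioms] by blast
  then have "x \<in> H1 \<and> y \<in> H2 \<or> y \<in> H1 \<and> x \<in> H2"
    using clique_arc[OF cl(1)] clique_arc[OF cl(2)] by blast
  then obtain a b where ab: "a \<in> H1" "b \<in> H2" "a \<noteq> b" "(a, b) \<notin> parcs G"
    using xy arc_sym by metis
  \<comment> \<open>A coincidence would put \<open>a\<close> and \<open>b\<close> into a common
    clique, making them adjacent.\<close>
  have neq: "a \<noteq> c" "a \<noteq> e" "b \<noteq> c" "b \<noteq> e"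
    using ab c e cl clique_arc by blast+
  have "(a, c) \<in> parcs G" "(b, e) \<in> parcs G" "(a, e) \<in> parcs G" "(c, b) \<in> parcs G" "(c, e) \<in> parcs G"
    using ab c e cl neq \<open>c \<noteq> e\<close> clique_arc by blast+
  moreover have "2 \<le> graph_dist G a b"
    using ab cl[THEN clique_subset] by (intro graph_dist_ge_2) auto
  ultimately show False
    using disjoint_arcs_dist_eq[of a c b e] ab neq \<open>c \<noteq> e\<close> by (auto simp: graph_dist_arc)
qed

text \<open>One further vertex from each clique would make a claw centred at the common vertex
  \<open>x\<close>.\<close>

lemma three_maximal_cliques_disjoint:
  assumes H: "maximal_clique G H1" "maximal_clique G H2" "maximal_clique G H3"
    and neq: "H1 \<noteq> H2" "H1 \<noteq> H3" "H2 \<noteq> H3"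
  shows "H1 \<inter> H2 \<inter> H3 = {}"
proof (rule ccontr)
  assume "H1 \<inter> H2 \<inter> H3 \<noteq> {}"
  then obtain x where x: "x \<in> H1" "x \<in> H2" "x \<in> H3" by blast
  obtain a b c where abc: "a \<in> H1" "a \<noteq> x" "b \<in> H2" "b \<noteq> x" "c \<in> H3" "c \<noteq> x"
    using maximal_clique_other_vertex H neq x by metis
  have arcs: "(x, a) \<in> parcs G" "(x, b) \<in> parcs G" "(x, c) \<in> parcs G"
    using abc x H maximal_clique_clique clique_arc by metis+
  \<comment> \<open>If \<open>u\<close> and \<open>v\<close> were adjacent, a maximal clique
    containing the triangle \<open>x\<close>, \<open>u\<close>, \<open>v\<close> would share two
    vertices with \<open>K\<close> and two with \<open>L\<close>, and so equal both.\<close>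
  have sep: "u \<noteq> v \<and> (u, v) \<notin> parcs G"
    if K: "maximal_clique G K" "maximal_clique G L" "K \<noteq> L" "x \<in> K" "x \<in> L"
      "u \<in> K" "u \<noteq> x" "v \<in> L" "v \<noteq> x" for K L u v
  proof (intro conjI notI)
    assume "u = v"
    then show False using maximal_cliques_eq[of K L x u] K by blast
  next
    assume uv: "(u, v) \<in> parcs G"
    have "(x, u) \<in> parcs G" "(x, v) \<in> parcs G"
      using K maximal_clique_clique clique_arc by metis+
    with uv have "clique G {x, u, v}"
      unfolding clique_iff[OF pair_graph_axioms] using arc_sym in_arcsD1 in_arcsD2 by blast
    then obtain M where M: "maximal_clique G M" "{x, u, v} \<subseteq> M"
      using clique_extends by blast
    then have "M = K" "M = L"
      using maximal_cliques_eq[of M K x u] maximal_cliques_eq[of M L x v] K by auto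
    then show False using K by blast
  qed
  show False
    using claw_free[OF arcs] sep[of H1 H2 a b] sep[of H1 H3 a c] sep[of H2 H3 b c] H neq x abc
    by blast
qed

section \<open>No cycles in the clique graph\<close>

lemma clique_graph_acyclic:
  assumes "pre_digraph.cycle (with_proj (clique_graph G)) p"
  shows "length p < 3"
proof (rule ccontr)
  interpret C: pair_graph "clique_graph G" by (rule pair_graph_clique_graph)
  assume "\<not> length p < 3"
  define n where "n = length p"
  have n: "3 \<le> n" using \<open>\<not> length p < 3\<close> by (simp add: n_def)
  obtain u where u: "C.awalk u p u" "distinct (tl (pawalk_verts u p))" "p \<noteq> []"
    using assms unfolding C.cycle_def by blast
  have cas: "pcas u p u" and arcs: "set p \<subseteq> parcs (clique_graph G)"
    using u(1) by (auto simp: C.awalk_def)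
  \<comment> \<open>\<open>K i\<close> is the head of arc \<open>i\<close>; its tail is
    \<open>K (i - 1)\<close>, or \<open>K (n - 1)\<close> when \<open>i\<close> is 0. The vertex
    \<open>x i\<close> chosen below lies in both, so \<open>x i\<close> and \<open>x (Suc i)\<close>
    both lie in \<open>K i\<close>.\<close>
  define K where "K i = snd (p ! i)" for i
  have dist: "K i \<noteq> K j" if "i < n" "j < n" "i \<noteq> j" for i j
  proof -
    have "distinct (map snd p)" using u(2) pcas_pawalk_verts[OF cas] by simp
    then show ?thesis
      using that nth_eq_iff_index_eq[of "map snd p" i j] by (simp add: K_def n_def)
  qed
  have arc: "(fst (p ! i), K i) \<in> parcs (clique_graph G)" if "i < n" for i
    using arcs that by (auto simp: K_def n_def)
  have max: "maximal_clique G (K i)" if "i < n" for i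
    using arc[OF that] by (simp add: clique_graph_def)
  have "\<forall>i. \<exists>y. i < n \<longrightarrow> y \<in> fst (p ! i) \<inter> K i"
    using arc by (auto simp: clique_graph_def)
  then obtain x where x: "\<And>i. i < n \<Longrightarrow> x i \<in> fst (p ! i) \<inter> K i"
    by metis
  have xK: "x i \<in> K i" if "i < n" for i
    using x[OF that] by blast
  have xSuc: "x (Suc i) \<in> K i" if "Suc i < n" for i
    using x[OF that] pcas_nth[OF cas, of i] that by (simp add: K_def n_def)
  have x0: "x 0 \<in> K (n - 1)"
  proof -
    have "fst (p ! 0) = K (n - 1)"
      using pcas_ends[OF cas u(3)] u(3) by (simp add: K_def n_def hd_conv_nth last_conv_nth)
    then show ?thesis using x[of 0] n by auto
  qed
  have meet: False if "i < n" "j < n" "k < n" "i \<noteq> j" "i \<noteq> k" "j \<noteq> k"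
    "y \<in> K i" "y \<in> K j" "y \<in> K k" for i j k y
    using three_maximal_cliques_disjoint[of "K i" "K j" "K k"] max dist that by blast
  \<comment> \<open>Here \<open>x i\<close> already lies in \<open>K (i - 1)\<close> and
    \<open>K i\<close>, both different from \<open>K 0\<close>.\<close>
  have notK0: "x i \<notin> K 0" if "2 \<le> i" "i < n" for i
  proof -
    obtain j where "i = Suc j" "j \<noteq> 0" using \<open>2 \<le> i\<close> by (cases i) auto
    then show ?thesis using meet[of 0 j i "x i"] xK[of i] xSuc[of j] that by auto
  qed
  have in0: "x 0 \<in> K 0" "x 1 \<in> K 0"
    using xK[of 0] xSuc[of 0] n by auto
  \<comment> \<open>If they were equal, this vertex would lie in \<open>K 0\<close>,
    \<open>K 1\<close> and \<open>K (n - 1)\<close>, which are distinct as \<open>n\<close> is at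
    least 3.\<close>
  have x01: "x 0 \<noteq> x 1"
    using meet[of 0 1 "n - 1" "x 0"] xK[of 0] xK[of 1] x0 n by force
  have K: "(y, z) \<in> parcs G" if "i < n" "y \<in> K i" "z \<in> K i" "y \<noteq> z" for i y z
    using that max maximal_clique_clique clique_arc by blast
  have V: "x i \<in> pverts G" if "i < n" for i
    using xK[OF that] max[OF that] maximal_clique_clique clique_subset by blast
  have a01: "(x 0, x 1) \<in> parcs G"
    using K[of 0] in0 x01 n by auto
  have ne: "x i \<noteq> x 0" "x i \<noteq> x 1" if "2 \<le> i" "i < n" for i
    using notK0[OF that] in0 by metis+
  have a12: "(x 1, x 2) \<in> parcs G"
    using K[of 1 "x 1" "x 2"] xK[of 1] xSuc[of 1] ne(2)[of 2] n by (auto simp: numeral_2_eq_2)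
  \<comment> \<open>A maximal clique around the triangle would share \<open>x 0\<close> and
    \<open>x 1\<close> with \<open>K 0\<close>, forcing \<open>x 2\<close> into
    \<open>K 0\<close>.\<close>
  have a02: "(x 0, x 2) \<notin> parcs G"
  proof
    assume a: "(x 0, x 2) \<in> parcs G"
    have "clique G {x 0, x 1, x 2}"
      unfolding clique_iff[OF pair_graph_axioms]
      using a a01 a12 arc_sym in_arcsD1 in_arcsD2 by blast
    then obtain M where M: "maximal_clique G M" "{x 0, x 1, x 2} \<subseteq> M"
      using clique_extends by blast
    then have "M = K 0"
      using maximal_cliques_eq[of M "K 0" "x 0" "x 1"] max[of 0] in0 x01 n by auto
    then show False using M notK0[of 2] n by auto
  qed
  \<comment> \<open>The induction starts with distances 1 and at least 2. Later arcs between
    consecutive \<open>x i\<close> are disjoint from \<open>(x 0, x 1)\<close>, so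
    \<open>disjoint_arcs_dist_eq\<close> preserves the difference of the two distances.\<close>
  have closer: "graph_dist G (x 1) (x i) < graph_dist G (x 0) (x i)" if "2 \<le> i" "i < n" for i
    using that
  proof (induction i rule: dec_induct)
    case base
    have "2 \<le> graph_dist G (x 0) (x 2)"
      using a02 ne(1)[of 2] V n by (intro graph_dist_ge_2) auto
    then show ?case using graph_dist_arc[OF a12] by simp
  next
    case (step i)
    show ?case
    proof (cases "x i = x (Suc i)")
      case True
      then show ?thesis using step by simp
    next
      case False
      then have "(x i, x (Suc i)) \<in> parcs G"
        using K[of i] xK[of i] xSuc[of i] step by simp
      then have "graph_dist G (x 0) (x i) + graph_dist G (x 1) (x (Suc i))
          = graph_dist G (x 0) (x (Suc i)) + graph_dist G (x 1) (x i)"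
        using ne[of i] ne[of "Suc i"] step by (intro disjoint_arcs_dist_eq[OF a01]) auto
      then show ?thesis using step by simp
    qed
  qed
  have n1: "2 \<le> n - 1" "n - 1 < n" using n by auto
  \<comment> \<open>The cycle closes: \<open>x 0\<close> and \<open>x (n - 1)\<close> both lie in
    \<open>K (n - 1)\<close>, so their distance is 1, and \<open>x 1\<close> cannot be strictly
    closer to \<open>x (n - 1)\<close>.\<close>
  have "(x 0, x (n - 1)) \<in> parcs G"
    using K[OF n1(2) x0 xK[OF n1(2)]] ne(1)[OF n1] by metis
  moreover have "1 \<le> graph_dist G (x 1) (x (n - 1))"
    using ne(2)[OF n1] V n by (intro graph_dist_pos) auto
  ultimately show False
    using closer[OF n1] by (simp add: graph_dist_arc)
qed

end

theorem theorem4p5: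
  fixes G :: "'a pair_pre_digraph"
  assumes "pair_graph G"
    and "Digraph_Component.connected (with_proj G)"
    and "2 \<le> card (pverts G)"
    and "QEC G < - (1 / 2)"
  shows "undirected_tree (clique_graph G) \<and>
    (\<forall>H1 H2. maximal_clique G H1 \<and> maximal_clique G H2 \<and> (H1, H2) \<in> parcs (clique_graph G)
       \<longrightarrow> card (H1 \<inter> H2) = 1) \<and>
    (\<forall>H1 H2 H3. maximal_clique G H1 \<and> maximal_clique G H2 \<and> maximal_clique G H3 \<and>
       H1 \<noteq> H2 \<and> H1 \<noteq> H3 \<and> H2 \<noteq> H3 \<longrightarrow> H1 \<inter> H2 \<inter> H3 = {})"
proof -
  interpret pair_graph G by fact
  interpret small_QEC_graph G
    using assms(2-4) by unfold_locales
  have "undirected_tree (clique_graph G)"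
    using pair_graph_clique_graph connected_clique_graph clique_graph_acyclic
    unfolding undirected_tree_def by (meson not_less)
  moreover have "card (H1 \<inter> H2) = 1"
    if H: "maximal_clique G H1" "maximal_clique G H2" and adj: "(H1, H2) \<in> parcs (clique_graph G)" for H1 H2
  proof -
    obtain x where x: "x \<in> H1" "x \<in> H2" and "H1 \<noteq> H2"
      using adj by (auto simp: clique_graph_def)
    then have "H1 \<inter> H2 = {x}"
      using maximal_cliques_eq[OF H] by blast
    then show ?thesis by simp
  qed
  ultimately show ?thesis
    using three_maximal_cliques_disjoint by blast
qed

end
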